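(* Let $\mathcal{A}$ be an infinite maximal almost disjoint family of infinite subsets of $\mathbb{N}$. Then the Alexandrov–Urysohn compactum $K(\mathcal{A})$ is a compact and sequentially compact space which does not have the $2$-Ramsey property.
   Context: For a set $S$ and a positive integer $r$, $[S]^r$ denotes the set of all $r$-element subsets of $S$. For an infinite set $S\subseteq\mathbb{N}$ and a topological space $X$, a function $f\colon[S]^r\to X$ converges to $p\in X$ if for every neighborhood $U$ of $p$ there is a finite set $F$ such that $f(s)\in U$ for all $s\in[S\setminus F]^r$. A space $X$ has the $r$-Ramsey property if for every function $f\colon[\mathbb{N}]^r\to X$ there are $p\in X$ and an infinite set $B\subseteq\mathbb{N}$ such that $f\restriction[B]^r$ converges to $p$. A space is sequentially compact if every sequence in it has a convergent subsequence. An almost disjoint family on a countable set $I$ is a family of infinite subsets of $I$ any two distinct members of which have finite intersection; it is maximal if it is not properly contained in another almost disjoint family on $I$. For such a family $\mathcal{A}$, the space $\Psi(\mathcal{A})$ has underlying set $I\cup\{p_A: A\in\mathcal{A}\}$ (with the $p_A$ distinct new points), the points of $I$ are isolated, and basic neighborhoods of $p_A$ are the sets $\{p_A\}\cup(A\setminus F)$ with $F\subseteq A$ finite. The Alexandrov–Urysohn compactum $K(\mathcal{A})=\Psi(\mathcal{A})\cup\{\infty\}$ is the one-point compactification of $\Psi(\mathcal{A})$: neighborhoods of $\infty$ are the sets containing $\infty$ together with the complement of a compact subset of $\Psi(\mathcal{A})$. *)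

theory Defs
  imports "HOL-Analysis.Analysis" "HOL-Library.Ramsey"
begin

definition almost_disjoint_family :: "'i set \<Rightarrow> 'i set set \<Rightarrow> bool" where
  "almost_disjoint_family I \<A> \<longleftrightarrow>
     countable I \<and> (\<forall>A\<in>\<A>. A \<subseteq> I \<and> infinite A) \<and> pairwise (\<lambda>A B. finite (A \<inter> B)) \<A>"

definition maximal_almost_disjoint_family :: "'i set \<Rightarrow> 'i set set \<Rightarrow> bool" where
  "maximal_almost_disjoint_family I \<A> \<longleftrightarrow>
     almost_disjoint_family I \<A> \<and> (\<nexists>\<B>. almost_disjoint_family I \<B> \<and> \<A> \<subset> \<B>)"

(* The point i of I is represented by Inl i, and the new point p_A by Inr A. *)
definition Psi_space :: "'i set \<Rightarrow> 'i set set \<Rightarrow> ('i + 'i set) topology" where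
  "Psi_space I \<A> = topology (\<lambda>U. U \<subseteq> Inl ` I \<union> Inr ` \<A> \<and>
     (\<forall>A. Inr A \<in> U \<longrightarrow> (\<exists>F. finite F \<and> F \<subseteq> A \<and> insert (Inr A) (Inl ` (A - F)) \<subseteq> U)))"

(* The predicate above satisfies the axioms of a topology, so that openin (Psi_space I \<A>) is
   indeed this predicate (the function "topology" is unspecified on other predicates). *)
lemma openin_Psi_space:
  "openin (Psi_space I \<A>) U \<longleftrightarrow> U \<subseteq> Inl ` I \<union> Inr ` \<A> \<and>
     (\<forall>A. Inr A \<in> U \<longrightarrow> (\<exists>F. finite F \<and> F \<subseteq> A \<and> insert (Inr A) (Inl ` (A - F)) \<subseteq> U))"
proof -
  let ?P = "\<lambda>U. U \<subseteq> Inl ` I \<union> Inr ` \<A> \<and>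
     (\<forall>A. Inr A \<in> U \<longrightarrow> (\<exists>F. finite F \<and> F \<subseteq> A \<and> insert (Inr A) (Inl ` (A - F)) \<subseteq> U))"
  have "?P (S \<inter> T)" if S: "?P S" and T: "?P T" for S T
  proof (intro conjI allI impI)
    show "S \<inter> T \<subseteq> Inl ` I \<union> Inr ` \<A>" using S by blast
  next
    fix A assume "Inr A \<in> S \<inter> T"
    then obtain F G where "finite F" "F \<subseteq> A" "insert (Inr A) (Inl ` (A - F)) \<subseteq> S"
      and "finite G" "G \<subseteq> A" "insert (Inr A) (Inl ` (A - G)) \<subseteq> T"
      using S T by (meson IntE)
    then show "\<exists>H. finite H \<and> H \<subseteq> A \<and> insert (Inr A) (Inl ` (A - H)) \<subseteq> S \<inter> T"
      by (intro exI[of _ "F \<union> G"]) blast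
  qed
  moreover have "?P (\<Union>\<K>)" if K: "\<forall>K\<in>\<K>. ?P K" for \<K>
  proof (intro conjI allI impI)
    show "\<Union>\<K> \<subseteq> Inl ` I \<union> Inr ` \<A>" using K by blast
  next
    fix A assume "Inr A \<in> \<Union>\<K>"
    then obtain K where "K \<in> \<K>" "Inr A \<in> K" by blast
    moreover then obtain F where "finite F" "F \<subseteq> A" "insert (Inr A) (Inl ` (A - F)) \<subseteq> K"
      using K by meson
    ultimately show "\<exists>F. finite F \<and> F \<subseteq> A \<and> insert (Inr A) (Inl ` (A - F)) \<subseteq> \<Union>\<K>"
      by blast
  qed
  ultimately have "istopology ?P"
    unfolding istopology_def by blast
  then show ?thesis
    unfolding Psi_space_def by (simp add: topology_inverse')
qed

lemma topspace_Psi_space: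
  assumes "almost_disjoint_family I \<A>"
  shows "topspace (Psi_space I \<A>) = Inl ` I \<union> Inr ` \<A>"
proof
  show "topspace (Psi_space I \<A>) \<subseteq> Inl ` I \<union> Inr ` \<A>"
    using openin_topspace[of "Psi_space I \<A>"] unfolding openin_Psi_space by blast
  have "openin (Psi_space I \<A>) (Inl ` I \<union> Inr ` \<A>)"
    unfolding openin_Psi_space
    using assms by (auto simp: almost_disjoint_family_def intro!: exI[of _ "{}"])
  then show "Inl ` I \<union> Inr ` \<A> \<subseteq> topspace (Psi_space I \<A>)"
    by (rule openin_subset)
qed

lemma Hausdorff_space_Psi_space:
  assumes AD: "almost_disjoint_family I \<A>"
  shows "Hausdorff_space (Psi_space I \<A>)"
proof -
  let ?N = "\<lambda>A F. insert (Inr A) (Inl ` (A - F))"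
  have sing: "openin (Psi_space I \<A>) {Inl i}" if "i \<in> I" for i
    using that by (auto simp: openin_Psi_space)
  have nbhd: "openin (Psi_space I \<A>) (?N A F)" if "A \<in> \<A>" "finite (A \<inter> F)" for A F
  proof -
    have "A \<subseteq> I" using AD that by (auto simp: almost_disjoint_family_def)
    then show ?thesis
      using that by (auto simp: openin_Psi_space intro!: exI[of _ "A \<inter> F"])
  qed
  have sep: "\<exists>U V. openin (Psi_space I \<A>) U \<and> openin (Psi_space I \<A>) V \<and>
      Inl i \<in> U \<and> Inr A \<in> V \<and> disjnt U V" if "i \<in> I" "A \<in> \<A>" for i A
    using sing[OF \<open>i \<in> I\<close>] nbhd[of A "{i}"] that
    by (intro exI[of _ "{Inl i}"] exI[of _ "?N A {i}"]) (auto simp: disjnt_def)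
  show ?thesis
    unfolding Hausdorff_space_def topspace_Psi_space[OF AD]
  proof (intro allI impI)
    fix x y :: "'a + 'a set"
    assume xy: "x \<in> Inl ` I \<union> Inr ` \<A> \<and> y \<in> Inl ` I \<union> Inr ` \<A> \<and> x \<noteq> y"
    show "\<exists>U V. openin (Psi_space I \<A>) U \<and> openin (Psi_space I \<A>) V \<and> x \<in> U \<and> y \<in> V \<and> disjnt U V"
    proof (cases x; cases y)
      fix i j assume "x = Inl i" "y = Inl j"
      then show ?thesis
        using xy sing[of i] sing[of j]
        by (intro exI[of _ "{x}"] exI[of _ "{y}"]) (auto simp: disjnt_def)
    next
      fix i A assume "x = Inl i" "y = Inr A"
      then show ?thesis using xy sep[of i A] by blast
    next
      fix A i assume "x = Inr A" "y = Inl i"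
      then show ?thesis using xy sep[of i A] by (metis (no_types, lifting) disjnt_sym Inl_Inr_False UnE imageE sum.inject)
    next
      fix A B assume e: "x = Inr A" "y = Inr B"
      then have "A \<in> \<A>" "B \<in> \<A>" "A \<noteq> B" using xy by auto
      moreover from this have "finite (A \<inter> B)"
        using AD by (auto simp: almost_disjoint_family_def pairwise_def)
      ultimately show ?thesis
        using e nbhd[of A B] nbhd[of B A]
        by (intro exI[of _ "?N A B"] exI[of _ "?N B A"]) (auto simp: disjnt_def Int_commute)
    qed
  qed
qed

(* Alexandroff_compactification also requires the removed compact sets to be closed; by
   Hausdorff_space_Psi_space this excludes nothing for an almost disjoint family. *)
definition AU_compactum :: "'i set \<Rightarrow> 'i set set \<Rightarrow> ('i + 'i set) option topology" where
  "AU_compactum I \<A> = Alexandroff_compactification (Psi_space I \<A>)"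

(* [S]^r is the library's nsets S r. *)
definition nsets_converges ::
    "'a topology \<Rightarrow> nat \<Rightarrow> (nat set \<Rightarrow> 'a) \<Rightarrow> nat set \<Rightarrow> 'a \<Rightarrow> bool" where
  "nsets_converges X r f S p \<longleftrightarrow>
     (\<forall>U. openin X U \<and> p \<in> U \<longrightarrow> (\<exists>F. finite F \<and> (\<forall>s\<in>nsets (S - F) r. f s \<in> U)))"

definition Ramsey_property :: "nat \<Rightarrow> 'a topology \<Rightarrow> bool" where
  "Ramsey_property r X \<longleftrightarrow>
     (\<forall>f \<in> nsets UNIV r \<rightarrow> topspace X.
        \<exists>p\<in>topspace X. \<exists>B. infinite B \<and> nsets_converges X r f B p)"

definition sequentially_compact_space :: "'a topology \<Rightarrow> bool" where
  "sequentially_compact_space X \<longleftrightarrow>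
     (\<forall>\<sigma>::nat \<Rightarrow> 'a. range \<sigma> \<subseteq> topspace X \<longrightarrow>
        (\<exists>l \<rho>. strict_mono \<rho> \<and> limitin X (\<sigma> \<circ> \<rho>) l sequentially))"

end

(* Sequential compactness: a sequence with finite fibres either meets I infinitely often, and then
   by maximality has a subsequence inside one member A of the family, which converges to p_A, or it
   does not, and then it converges to the point at infinity, because a compact subset of Psi
   contains only finitely many of the points p_A.

   Failure of the 2-Ramsey property: choose infinitely many distinct members a_0, a_1, ..., make
   them disjoint by removing from a_m the earlier ones, and for m < n send {m, n} to the n-th point
   of the m-th set, so that f is injective and f{m, n} tends to p_(a_m) as n grows. This rules out
   every limit on an infinite set B except infinity. For infinity, assign to each m in B a larger
   element m' of B; the points f{m, m'} form an infinite set D, which by maximality meets some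
   member A infinitely often, so the values on [B]^2 keep returning to the compact set
   A together with p_A. *)
theory Submission
  imports Defs
begin

text \<open>Otherwise \<open>insert D \<A>\<close> would be a strictly larger almost disjoint
  family: \<open>D\<close> is not already a member, since it meets itself infinitely. Both halves of
  the proof use maximality in this form.\<close>

lemma maximal_almost_disjoint_family_infinite_Int:
  assumes M: "maximal_almost_disjoint_family I \<A>" and D: "D \<subseteq> I" "infinite D"
  obtains A where "A \<in> \<A>" "infinite (A \<inter> D)"
proof (rule ccontr)
  assume "\<not> thesis"
  with that have fin: "finite (A \<inter> D)" if "A \<in> \<A>" for A
    using that by blast
  have AD: "almost_disjoint_family I \<A>"
    using M by (simp add: maximal_almost_disjoint_family_def)
  have "pairwise (\<lambda>A B. finite (A \<inter> B)) (insert D \<A>)"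
    using AD fin by (auto simp: almost_disjoint_family_def pairwise_insert Int_commute)
  then have "almost_disjoint_family I (insert D \<A>)"
    using AD D by (auto simp: almost_disjoint_family_def)
  moreover have "D \<notin> \<A>"
    using fin D by force
  ultimately show False
    using M unfolding maximal_almost_disjoint_family_def by blast
qed

section \<open>Basic open sets and compact subsets of the Psi space\<close>

lemma openin_Psi_space_basic:
  assumes "almost_disjoint_family I \<A>" "A \<in> \<A>"
  shows "openin (Psi_space I \<A>) (insert (Inr A) (Inl ` A))"
  using assms by (auto simp: openin_Psi_space almost_disjoint_family_def intro!: exI[of _ "{}"])

lemma openin_Psi_space_singleton:
  assumes "i \<in> I"
  shows "openin (Psi_space I \<A>) {Inl i}"
  using assms by (auto simp: openin_Psi_space)

text \<open>A cover member containing \<open>Inr A\<close> already contains all but finitely many of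
  the points \<open>Inl i\<close> with \<open>i\<close> in \<open>A\<close>; finitely many further
  members take care of the exceptions.\<close>

lemma compactin_Psi_space_basic:
  assumes AD: "almost_disjoint_family I \<A>" and "A \<in> \<A>"
  shows "compactin (Psi_space I \<A>) (insert (Inr A) (Inl ` A))"
  unfolding compactin_def
proof (intro conjI allI impI)
  show "insert (Inr A) (Inl ` A) \<subseteq> topspace (Psi_space I \<A>)"
    using openin_subset[OF openin_Psi_space_basic[OF assms]] .
next
  fix \<U>
  assume \<U>: "Ball \<U> (openin (Psi_space I \<A>)) \<and> insert (Inr A) (Inl ` A) \<subseteq> \<Union>\<U>"
  then obtain U where U: "U \<in> \<U>" "Inr A \<in> U" by auto
  then obtain F where F: "finite F" "F \<subseteq> A" "Inl ` (A - F) \<subseteq> U"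
    using \<U> unfolding openin_Psi_space by (metis insert_subset)
  have "finite (Inl ` F)" "Inl ` F \<subseteq> \<Union>\<U>"
    using F(1) by simp (use F(2) \<U> in blast)
  then obtain \<F> where "finite \<F>" "\<F> \<subseteq> \<U>" "Inl ` F \<subseteq> \<Union>\<F>"
    using finite_subset_Union by metis
  moreover have "Inl ` A \<subseteq> Inl ` (A - F) \<union> Inl ` F"
    by blast
  then have "Inl ` A \<subseteq> U \<union> \<Union>\<F>"
    using F(3) \<open>Inl ` F \<subseteq> \<Union>\<F>\<close> by (meson Un_mono subset_trans)
  then have "insert (Inr A) (Inl ` A) \<subseteq> \<Union>(insert U \<F>)"
    using U(2) by simp
  ultimately show "\<exists>\<F>. finite \<F> \<and> \<F> \<subseteq> \<U> \<and> insert (Inr A) (Inl ` A) \<subseteq> \<Union>\<F>"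
    using U(1) by (metis finite_insert insert_subset)
qed

text \<open>In the cover by isolated points and basic neighbourhoods, \<open>Inr A\<close> lies only
  in its own \<open>?N A\<close>. So a finite subcover contains \<open>?N A\<close> for every
  \<open>Inr A\<close> in \<open>C\<close>, and \<open>?N\<close> is injective.\<close>

lemma compactin_Psi_space_finite_Inr:
  assumes AD: "almost_disjoint_family I \<A>" and C: "compactin (Psi_space I \<A>) C"
  shows "finite {A. Inr A \<in> C}"
proof -
  let ?N = "\<lambda>A. insert (Inr A) (Inl ` A) :: ('a + 'a set) set"
  let ?\<U> = "(\<lambda>i. {Inl i}) ` I \<union> ?N ` \<A>"
  have "\<exists>\<F>. finite \<F> \<and> \<F> \<subseteq> ?\<U> \<and> C \<subseteq> \<Union>\<F>"
  proof (rule compactinD[OF C])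
    show "C \<subseteq> \<Union>?\<U>"
      using compactin_subset_topspace[OF C] unfolding topspace_Psi_space[OF AD] by auto
    show "openin (Psi_space I \<A>) U" if "U \<in> ?\<U>" for U
      using that openin_Psi_space_basic[OF AD] openin_Psi_space_singleton[of _ I \<A>] by auto
  qed
  then obtain \<F> where \<F>: "finite \<F>" "\<F> \<subseteq> ?\<U>" "C \<subseteq> \<Union>\<F>"
    by (elim exE conjE)
  have sub: "?N ` {A. Inr A \<in> C} \<subseteq> \<F>"
  proof (clarify)
    fix A assume "Inr A \<in> C"
    then obtain U where "U \<in> \<F>" "Inr A \<in> U" using \<F> by auto
    moreover from this have "U = ?N A" using \<F>(2) by auto
    ultimately show "?N A \<in> \<F>" by simp
  qed
  have "inj_on ?N {A. Inr A \<in> C}"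
    by (auto simp: inj_on_def)
  with finite_subset[OF sub \<F>(1)] show ?thesis
    by (rule finite_imageD)
qed

section \<open>Open sets of the compactum\<close>

lemma openin_AU_compactum_Some:
  "openin (Psi_space I \<A>) U \<Longrightarrow> openin (AU_compactum I \<A>) (Some ` U)"
  by (simp add: AU_compactum_def)

lemma openin_AU_compactum_SomeD:
  assumes "openin (AU_compactum I \<A>) V"
  shows "openin (Psi_space I \<A>) (Some -` V)"
proof -
  have "openin (Psi_space I \<A>) {x \<in> topspace (Psi_space I \<A>). Some x \<in> V}"
    using continuous_map_Some assms openin_continuous_map_preimage
    unfolding AU_compactum_def by blast
  moreover have "Some -` V \<subseteq> topspace (Psi_space I \<A>)"
    using openin_subset[OF assms] by (auto simp: AU_compactum_def)
  ultimately show ?thesis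
    by (simp add: vimage_def subset_eq Collect_conj_eq Int_absorb1)
qed

text \<open>The removed set is compact, hence closed because the Psi space is Hausdorff. This
  neighbourhood of infinity later refutes convergence to \<open>None\<close>.\<close>

lemma openin_AU_compactum_Compl_basic:
  assumes AD: "almost_disjoint_family I \<A>" and "A \<in> \<A>"
  shows "openin (AU_compactum I \<A>)
    (insert None (Some ` (topspace (Psi_space I \<A>) - insert (Inr A) (Inl ` A))))"
  using compactin_Psi_space_basic[OF assms]
    compactin_imp_closedin[OF Hausdorff_space_Psi_space[OF AD]]
  unfolding AU_compactum_def openin_Alexandroff_compactification by blast

section \<open>Sequential compactness\<close>

text \<open>An increasing enumeration of \<open>M\<close> is injective, so the finitely many bad
  indices in \<open>M\<close> pull back to finitely many positions of the subsequence.\<close>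

lemma convergent_subsequence_along:
  assumes l: "l \<in> topspace X" and M: "infinite (M :: nat set)"
    and fin: "\<And>U. openin X U \<Longrightarrow> l \<in> U \<Longrightarrow> finite {n \<in> M. \<sigma> n \<notin> U}"
  shows "\<exists>l \<rho>. strict_mono \<rho> \<and> limitin X (\<sigma> \<circ> \<rho>) l sequentially"
proof -
  obtain \<rho> :: "nat \<Rightarrow> nat" where \<rho>: "strict_mono \<rho>" "\<And>n. \<rho> n \<in> M"
    using infinite_enumerate[OF M] by blast
  have "\<forall>\<^sub>F n in sequentially. (\<sigma> \<circ> \<rho>) n \<in> U" if "openin X U" "l \<in> U" for U
  proof -
    have "finite (\<rho> -` {n \<in> M. \<sigma> n \<notin> U})"
      using fin[OF that] \<rho>(1) by (intro finite_vimageI strict_mono_imp_inj_on)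
    moreover have "\<rho> -` {n \<in> M. \<sigma> n \<notin> U} = {n. \<not> (\<sigma> \<circ> \<rho>) n \<in> U}"
      using \<rho>(2) by auto
    ultimately show ?thesis
      by (simp add: cofinite_eq_sequentially[symmetric] eventually_cofinite)
  qed
  then show ?thesis
    using \<rho>(1) l unfolding limitin_def by blast
qed

lemma sequentially_compact_space_AU_compactum:
  assumes M: "maximal_almost_disjoint_family I \<A>"
  shows "sequentially_compact_space (AU_compactum I \<A>)"
  unfolding sequentially_compact_space_def
proof (intro allI impI)
  let ?K = "AU_compactum I \<A>"
  fix \<sigma> :: "nat \<Rightarrow> ('a + 'a set) option"
  assume ran: "range \<sigma> \<subseteq> topspace ?K"
  have AD: "almost_disjoint_family I \<A>"
    using M by (simp add: maximal_almost_disjoint_family_def)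
  have top: "topspace ?K = insert None (Some ` (Inl ` I \<union> Inr ` \<A>))"
    by (simp add: AU_compactum_def topspace_Psi_space[OF AD])
  show "\<exists>l \<rho>. strict_mono \<rho> \<and> limitin ?K (\<sigma> \<circ> \<rho>) l sequentially"
  proof (cases "\<exists>x. infinite (\<sigma> -` {x})")
    case True
    then obtain x where x: "infinite (\<sigma> -` {x})" ..
    then have "\<sigma> -` {x} \<noteq> {}" by force
    then have "x \<in> topspace ?K" using ran by auto
    then show ?thesis
      using x by (rule convergent_subsequence_along) (auto intro: finite_subset[OF _ finite.emptyI])
  next
    case False
    \<comment> \<open>With all fibres finite, it suffices below to show that the values outside a
      neighbourhood form a finite set.\<close>
    then have fin: "finite (\<sigma> -` T)" if "finite T" for T
    proof -
      have "\<sigma> -` T = (\<Union>x\<in>T. \<sigma> -` {x})" by auto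
      then show ?thesis using that False by simp
    qed
    define D where "D = {i. Some (Inl i) \<in> range \<sigma>}"
    have D: "D \<subseteq> I"
      using ran unfolding top D_def by auto
    show ?thesis
    proof (cases "finite D")
      case False
      then obtain A where A: "A \<in> \<A>" "infinite (A \<inter> D)"
        using maximal_almost_disjoint_family_infinite_Int[OF M D] by blast
      \<comment> \<open>The indices whose values lie in \<open>A\<close>; there are infinitely many
        because their values exhaust the infinite set \<open>A \<inter> D\<close>.\<close>
      let ?M = "\<sigma> -` (\<lambda>i. Some (Inl i)) ` A"
      have "(\<lambda>i. Some (Inl i)) ` (A \<inter> D) \<subseteq> \<sigma> ` ?M"
        by (auto simp: D_def)
      moreover have "infinite ((\<lambda>i. Some (Inl i) :: ('a + 'a set) option) ` (A \<inter> D))"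
        using A(2) by (subst finite_image_iff) (auto simp: inj_on_def)
      ultimately have inf: "infinite ?M"
        by (meson finite_imageI finite_subset)
      show ?thesis
      proof (rule convergent_subsequence_along[OF _ inf])
        show "Some (Inr A) \<in> topspace ?K"
          using A by (simp add: top)
      next
        fix U assume U: "openin ?K U" "Some (Inr A) \<in> U"
        then obtain F where F: "finite F" "Inl ` (A - F) \<subseteq> Some -` U"
          using openin_AU_compactum_SomeD[OF U(1)] unfolding openin_Psi_space
          by (metis insert_subset vimageI2)
        have "i \<in> F" if "i \<in> A" "Some (Inl i) \<notin> U" for i
          using F(2) that by blast
        then have "{n \<in> ?M. \<sigma> n \<notin> U} \<subseteq> \<sigma> -` (\<lambda>i. Some (Inl i)) ` F"
          by auto
        then show "finite {n \<in> ?M. \<sigma> n \<notin> U}"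
          using fin F(1) by (meson finite_imageI finite_subset)
      qed
    next
      case True
      show ?thesis
      proof (rule convergent_subsequence_along)
        show "None \<in> topspace ?K"
          by (simp add: top)
        show "infinite (UNIV :: nat set)" by simp
      next
        fix U assume U: "openin ?K U" "None \<in> U"
        then obtain C where C: "compactin (Psi_space I \<A>) C"
          "U = insert None (Some ` (topspace (Psi_space I \<A>) - C))"
          unfolding AU_compactum_def openin_Alexandroff_compactification by auto
        \<comment> \<open>A value outside \<open>U\<close> is a point of \<open>C\<close>: either a
          visited point of \<open>I\<close>, hence from the finite set \<open>D\<close>, or one of
          the finitely many \<open>Inr A\<close> in \<open>C\<close>.\<close>
        let ?T = "(\<lambda>i. Some (Inl i)) ` D \<union> (\<lambda>A. Some (Inr A)) ` {A. Inr A \<in> C}"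
        have "finite ?T"
          using True compactin_Psi_space_finite_Inr[OF AD C(1)] by simp
        moreover have "{n \<in> UNIV. \<sigma> n \<notin> U} \<subseteq> \<sigma> -` ?T"
        proof (clarify)
          fix n assume n: "\<sigma> n \<notin> U"
          have "\<sigma> n \<in> topspace ?K" using ran by auto
          with n obtain x where x: "\<sigma> n = Some x" "x \<in> C"
            by (auto simp: C(2) AU_compactum_def)
          show "n \<in> \<sigma> -` ?T"
          proof (cases x)
            case (Inl i)
            then have "i \<in> D" using x(1) unfolding D_def by (metis mem_Collect_eq rangeI)
            then show ?thesis using x(1) Inl by simp
          next
            case (Inr A)
            then show ?thesis using x by simp
          qed
        qed
        ultimately show "finite {n \<in> UNIV. \<sigma> n \<notin> U}"
          using fin finite_subset by blast
      qed
    qed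
  qed
qed

section \<open>Failure of the 2-Ramsey property\<close>

text \<open>Each \<open>a m\<close> loses only finitely many points to the earlier members, so the
  remainders are infinite and pairwise disjoint. Row \<open>e m\<close> enumerates points of the
  m-th remainder without repetition, and disjointness makes \<open>e\<close> jointly
  injective.\<close>

lemma infinite_almost_disjoint_family_injection:
  assumes AD: "almost_disjoint_family I \<A>" and "infinite \<A>"
  obtains a :: "nat \<Rightarrow> 'i set" and e :: "nat \<Rightarrow> nat \<Rightarrow> 'i"
  where "inj a" "range a \<subseteq> \<A>" "\<And>m n. e m n \<in> a m" "inj (\<lambda>(m, n). e m n)"
proof -
  obtain a :: "nat \<Rightarrow> 'i set" where a: "inj a" "range a \<subseteq> \<A>"
    using infinite_countable_subset[OF \<open>infinite \<A>\<close>] by blast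
  define A where "A m = a m - (\<Union>k<m. a k)" for m
  have "infinite (A m)" for m
  proof -
    have "finite (a m \<inter> a k)" if "k < m" for k
    proof -
      have "a m \<noteq> a k" using that a(1) by (metis injD less_irrefl)
      then show ?thesis
        using AD a(2) unfolding almost_disjoint_family_def pairwise_def by blast
    qed
    then have "finite (\<Union>k<m. a m \<inter> a k)" by blast
    moreover have "infinite (a m)"
      using AD a(2) unfolding almost_disjoint_family_def by blast
    moreover have "a m = A m \<union> (\<Union>k<m. a m \<inter> a k)"
      by (auto simp: A_def)
    ultimately show ?thesis
      by (metis finite_UnI)
  qed
  then have "\<exists>e :: nat \<Rightarrow> 'i. inj e \<and> range e \<subseteq> A m" for m
    by (rule infinite_countable_subset)
  then obtain e :: "nat \<Rightarrow> nat \<Rightarrow> 'i" where e: "\<And>m. inj (e m)" "\<And>m. range (e m) \<subseteq> A m"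
    by metis
  have eA: "e m n \<in> A m" for m n
    using e(2) by blast
  have disj: "A m \<inter> A k = {}" if "m \<noteq> k" for m k
    using that by (auto simp: A_def neq_iff)
  have "inj (\<lambda>(m, n). e m n)"
  proof (rule injI, clarify)
    fix m n k l assume eq: "e m n = e k l"
    then have "m = k" using disj[of m k] eA[of m n] eA[of k l] by auto
    with eq show "m = k \<and> n = l" using e(1)[of k] by (auto dest: injD)
  qed
  moreover have "e m n \<in> a m" for m n
    using eA[of m n] by (simp add: A_def)
  ultimately show thesis
    using that a by blast
qed

lemma not_Ramsey_property_2_AU_compactum:
  assumes M: "maximal_almost_disjoint_family I \<A>" and inf: "infinite \<A>"
  shows "\<not> Ramsey_property 2 (AU_compactum I \<A>)"
proof
  let ?K = "AU_compactum I \<A>"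
  assume R: "Ramsey_property 2 ?K"
  have AD: "almost_disjoint_family I \<A>"
    using M by (simp add: maximal_almost_disjoint_family_def)
  have top: "topspace ?K = insert None (Some ` (Inl ` I \<union> Inr ` \<A>))"
    by (simp add: AU_compactum_def topspace_Psi_space[OF AD])
  obtain a :: "nat \<Rightarrow> 'a set" and e :: "nat \<Rightarrow> nat \<Rightarrow> 'a"
    where a: "inj a" "range a \<subseteq> \<A>"
    and ea: "\<And>m n. e m n \<in> a m" and "inj (\<lambda>(m, n). e m n)"
    using infinite_almost_disjoint_family_injection[OF AD inf] by blast
  then have e_eq: "e m n = e k l \<longleftrightarrow> m = k \<and> n = l" for m n k l
    by (auto dest: injD[of _ "(m, n)" "(k, l)"])
  have aI: "a m \<subseteq> I" for m
    using AD a(2) unfolding almost_disjoint_family_def by blast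
  \<comment> \<open>\<open>Min\<close> and \<open>Max\<close> recover the ordered pair: the smaller
    element selects the row, the larger one the position in it.\<close>
  define f where "f s = Some (Inl (e (Min s) (Max s)) :: 'a + 'a set)" for s
  have f: "f {m, n} = Some (Inl (e m n))" if "m < n" for m n
    using that by (simp add: f_def)
  have "f \<in> nsets UNIV 2 \<rightarrow> topspace ?K"
    using ea aI unfolding top f_def by blast
  then obtain p B where p: "p \<in> topspace ?K" and B: "infinite B"
    and conv: "nsets_converges ?K 2 f B p"
    using R unfolding Ramsey_property_def by blast
  have evt: "\<exists>F. finite F \<and> (\<forall>m\<in>B - F. \<forall>n\<in>B - F. m < n \<longrightarrow> Some (Inl (e m n)) \<in> U)"
    if U: "openin ?K U" "p \<in> U" for U
  proof -
    obtain F where F: "finite F" "\<forall>s\<in>nsets (B - F) 2. f s \<in> U"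
      using conv U unfolding nsets_converges_def by blast
    have "Some (Inl (e m n)) \<in> U" if "m \<in> B - F" "n \<in> B - F" "m < n" for m n
      using F(2)[rule_format, of "{m, n}"] that f by simp
    with F(1) show ?thesis by blast
  qed
  have inf_above: "infinite {n \<in> B - F. m < n}" if "finite F" for F m
  proof -
    have "{n \<in> B - F. m < n} = B - (F \<union> {..m})" by auto
    then show ?thesis using B that by simp
  qed
  have no_row: False
    if "openin ?K (Some ` U)" "p \<in> Some ` U" and fin: "\<And>m. m > k \<Longrightarrow> finite {n. Inl (e m n) \<in> U}"
    for U k
  proof -
    obtain F where F: "finite F"
      "\<And>m n. m \<in> B - F \<Longrightarrow> n \<in> B - F \<Longrightarrow> m < n \<Longrightarrow> Some (Inl (e m n)) \<in> Some ` U"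
      using evt[OF \<open>openin ?K (Some ` U)\<close> \<open>p \<in> Some ` U\<close>] by blast
    obtain m where m: "m \<in> B - F" "m > k"
      using infinite_imp_nonempty[OF inf_above[OF F(1), of k]] by blast
    have "{n \<in> B - F. m < n} \<subseteq> {n. Inl (e m n) \<in> U}"
      using F(2)[OF m(1)] by blast
    then show False
      using fin[OF m(2)] inf_above[OF F(1)] finite_subset by blast
  qed
  consider i where "i \<in> I" "p = Some (Inl i)" | A where "A \<in> \<A>" "p = Some (Inr A)" | "p = None"
    using p unfolding top by blast
  then show False
  proof cases
    case 1
    show False
    proof (rule no_row)
      show "openin ?K (Some ` {Inl i})"
        using openin_Psi_space_singleton 1(1) by (intro openin_AU_compactum_Some)
      show "p \<in> Some ` {Inl i}"
        using 1 by simp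
      fix m :: nat
      have "inj (e m)"
        by (auto simp: inj_def e_eq)
      then have "finite (e m -` {i})"
        by (simp add: finite_vimageI)
      then show "finite {n. Inl (e m n) \<in> {Inl i}}"
        by (simp add: vimage_def)
    qed
  next
    case 2
    \<comment> \<open>By injectivity \<open>A\<close> is \<open>a k\<close> for at most one
      \<open>k\<close>; every later row then meets \<open>A\<close> in a finite set.\<close>
    obtain k where k: "\<And>m. m > k \<Longrightarrow> a m \<noteq> A"
    proof (cases "A \<in> range a")
      case True
      then obtain k where "A = a k" by blast
      then show thesis using that[of k] a(1) by (auto dest: injD)
    qed (use that in blast)
    show False
    proof (rule no_row)
      show "openin ?K (Some ` insert (Inr A) (Inl ` A))"
        using openin_Psi_space_basic[OF AD 2(1)] by (rule openin_AU_compactum_Some)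
      show "p \<in> Some ` insert (Inr A) (Inl ` A)"
        using 2 by simp
      fix m assume "m > k"
      then have "finite (a m \<inter> A)"
        using k[of m] AD a(2) 2(1) unfolding almost_disjoint_family_def pairwise_def by blast
      moreover have "inj (e m)"
        by (auto simp: inj_def e_eq)
      ultimately have "finite (e m -` (a m \<inter> A))"
        by (rule finite_vimageI)
      moreover have "{n. Inl (e m n) \<in> insert (Inr A) (Inl ` A)} = e m -` (a m \<inter> A)"
        using ea by auto
      ultimately show "finite {n. Inl (e m n) \<in> insert (Inr A) (Inl ` A)}"
        by simp
    qed
  next
    case 3
    have "\<exists>n. n \<in> B \<and> m < n" for m
      using infinite_imp_nonempty[OF inf_above[OF finite.emptyI, of m]] by blast
    then obtain nx where nx: "\<And>m. nx m \<in> B" "\<And>m. m < nx m"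
      by metis
    let ?g = "\<lambda>m. e m (nx m)"
    have "inj_on ?g B"
      by (auto simp: inj_on_def e_eq)
    then have "infinite (?g ` B)"
      using B finite_imageD by blast
    moreover have "?g ` B \<subseteq> I"
      using ea aI by blast
    ultimately obtain A where A: "A \<in> \<A>" "infinite (A \<inter> ?g ` B)"
      using maximal_almost_disjoint_family_infinite_Int[OF M] by blast
    let ?U = "insert None (Some ` (topspace (Psi_space I \<A>) - insert (Inr A) (Inl ` A)))"
    obtain F where F: "finite F"
      "\<And>m n. m \<in> B - F \<Longrightarrow> n \<in> B - F \<Longrightarrow> m < n \<Longrightarrow> Some (Inl (e m n)) \<in> ?U"
      using evt[OF openin_AU_compactum_Compl_basic[OF AD A(1)]] 3 by blast
    \<comment> \<open>Once \<open>m\<close> exceeds all of \<open>F\<close>, both \<open>m\<close>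
      and \<open>nx m\<close> avoid \<open>F\<close>, so \<open>e m (nx m)\<close> must lie in
      \<open>?U\<close>, which excludes \<open>A\<close>. Inserting 0 keeps \<open>Max\<close>
      meaningful when \<open>F\<close> is empty.\<close>
    have "A \<inter> ?g ` B \<subseteq> ?g ` {..Max (insert 0 F)}"
    proof (clarify)
      fix m assume m: "m \<in> B" "e m (nx m) \<in> A"
      have "\<not> Max (insert 0 F) < m"
      proof
        assume less: "Max (insert 0 F) < m"
        then have "m \<notin> F" "nx m \<notin> F"
          using F(1) nx(2)[of m] by auto
        then have "Some (Inl (e m (nx m))) \<in> ?U"
          using F(2)[of m "nx m"] m nx by auto
        then show False using m by auto
      qed
      then show "e m (nx m) \<in> ?g ` {..Max (insert 0 F)}" by auto
    qed
    then show False
      using A(2) finite_subset by blast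
  qed
qed

theorem mainTheorem3:
  fixes \<A> :: "nat set set"
  assumes "maximal_almost_disjoint_family UNIV \<A>" and "infinite \<A>"
  shows "compact_space (AU_compactum UNIV \<A>) \<and>
    sequentially_compact_space (AU_compactum UNIV \<A>) \<and>
    \<not> Ramsey_property 2 (AU_compactum UNIV \<A>)"
  using sequentially_compact_space_AU_compactum[OF assms(1)]
    not_Ramsey_property_2_AU_compactum[OF assms]
  \<comment> \<open>Compactness holds for every Alexandroff compactification.\<close>
  by (simp add: AU_compactum_def)

end
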